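(* Let $G$ be an infinite group, let $A, B \subset G$ be disjoint subsets, and let $W = W_G(A,B)$. If a subset $X \subset G$ satisfies $X = X^{-1}$ and $XAX \cap B = \varnothing$, then $X \subset W$. In particular, if $W$ is finite, then $A$ and $B$ are not separable in $G$.
   Context: Let $G$ be an infinite group with identity $e$, and let $A, B \subset G$ be disjoint subsets. Write $XAX = \{x a x' : x, x' \in X,\ a \in A\}$. We say $A$ and $B$ are separable in $G$ if there exists a subset $X \subset G$ such that (1) $X$ is infinite; (2) $e \in X$; (3) $X = X^{-1}$, i.e. $x \in X \Rightarrow x^{-1} \in X$; (4) $XAX \cap B = \varnothing$. Define $W_G(A,B) := \{u \in G : \{u,u^{-1}\}\, A\, \{u,u^{-1}\} \cap B = \varnothing\}$, i.e. $u \in W_G(A,B)$ if and only if the four sets $uAu$, $uAu^{-1}$, $u^{-1}Au$, $u^{-1}Au^{-1}$ are all disjoint from $B$. *)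

theory Defs
  imports "HOL-Algebra.Coset"
begin

definition separable :: "('a, 'b) monoid_scheme \<Rightarrow> 'a set \<Rightarrow> 'a set \<Rightarrow> bool"
  where "separable G A B \<longleftrightarrow>
    (\<exists>X \<subseteq> carrier G. infinite X \<and> \<one>\<^bsub>G\<^esub> \<in> X \<and> X = set_inv\<^bsub>G\<^esub> X \<and>
      (X <#>\<^bsub>G\<^esub> A <#>\<^bsub>G\<^esub> X) \<inter> B = {})"

definition sep_W :: "('a, 'b) monoid_scheme \<Rightarrow> 'a set \<Rightarrow> 'a set \<Rightarrow> 'a set"
  where "sep_W G A B =
    {u \<in> carrier G.
      ({u, inv\<^bsub>G\<^esub> u} <#>\<^bsub>G\<^esub> A <#>\<^bsub>G\<^esub> {u, inv\<^bsub>G\<^esub> u}) \<inter> B = {}}"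

end

theory Submission
  imports Defs
begin

text \<open>For \<open>u \<in> X\<close>, symmetry of \<open>X\<close> puts the whole pair \<open>{u, u\<inverse>}\<close> inside \<open>X\<close>, and
  a product of sets is monotone in its factors, so \<open>{u, u\<inverse>} A {u, u\<inverse>}\<close> inherits from \<open>X A X\<close>
  its disjointness from \<open>B\<close>. A set witnessing separability is therefore an infinite subset of
  \<open>sep_W G A B\<close>.\<close>

lemma symmetric_subset_sep_W:
  assumes "X \<subseteq> carrier G" and sym: "X = set_inv\<^bsub>G\<^esub> X"
    and disj: "(X <#>\<^bsub>G\<^esub> A <#>\<^bsub>G\<^esub> X) \<inter> B = {}"
  shows "X \<subseteq> sep_W G A B"
proof
  fix u assume u: "u \<in> X"
  then have "inv\<^bsub>G\<^esub> u \<in> set_inv\<^bsub>G\<^esub> X"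
    by (auto simp: SET_INV_def)
  with u sym have pair: "{u, inv\<^bsub>G\<^esub> u} \<subseteq> X"
    by simp
  have "{u, inv\<^bsub>G\<^esub> u} <#>\<^bsub>G\<^esub> A <#>\<^bsub>G\<^esub> {u, inv\<^bsub>G\<^esub> u} \<subseteq> X <#>\<^bsub>G\<^esub> A <#>\<^bsub>G\<^esub> X"
    by (intro mono_set_mult pair subset_refl)
  with u assms(1) disj show "u \<in> sep_W G A B"
    unfolding sep_W_def by blast
qed

theorem lemma3p1:
  fixes G :: "('a, 'b) monoid_scheme" and A B :: "'a set"
  assumes "group G"
    and "infinite (carrier G)"
    and "A \<subseteq> carrier G" and "B \<subseteq> carrier G"
    and "A \<inter> B = {}"
  shows "(\<forall>X \<subseteq> carrier G.
            X = set_inv\<^bsub>G\<^esub> X \<longrightarrow> (X <#>\<^bsub>G\<^esub> A <#>\<^bsub>G\<^esub> X) \<inter> B = {} \<longrightarrow> X \<subseteq> sep_W G A B)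
       \<and> (finite (sep_W G A B) \<longrightarrow> \<not> separable G A B)"
proof (intro conjI allI impI)
  fix X
  assume "X \<subseteq> carrier G" "X = set_inv\<^bsub>G\<^esub> X" "(X <#>\<^bsub>G\<^esub> A <#>\<^bsub>G\<^esub> X) \<inter> B = {}"
  then show "X \<subseteq> sep_W G A B"
    by (rule symmetric_subset_sep_W)
next
  assume fin: "finite (sep_W G A B)"
  show "\<not> separable G A B"
  proof
    assume "separable G A B"
    then obtain X where X: "X \<subseteq> carrier G" "X = set_inv\<^bsub>G\<^esub> X"
        "(X <#>\<^bsub>G\<^esub> A <#>\<^bsub>G\<^esub> X) \<inter> B = {}" and inf: "infinite X"
      unfolding separable_def by blast
    from X have "X \<subseteq> sep_W G A B"
      by (rule symmetric_subset_sep_W)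
    with fin inf show False
      using finite_subset by blast
  qed
qed

end
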